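(* Let $d\ge 3$ and let $Q_d$ be the $d$-cube graph. The incidence structure $N(Q_d)$ is a $(2^d_d)$ configuration which is the disjoint union of two incidence structures, each isomorphic to the Clifford configuration of type $(2^{d-1}_d)$; and $N(Q_d)$ can be realized in the plane as an isometric point-circle configuration, whose two components are isometric $(2^{d-1}_d)$ point-circle configurations.
   Context: $Q_d$ has vertex set $\{0,1\}^d$, two vertices adjacent iff they differ in exactly one coordinate. For a graph $G$ and vertex $v$, $N(v)$ is the set of neighbours of $v$; $N(G)$ is the incidence structure with points $V(G)$, blocks $\{N(v)\mid v\in V(G)\}$, incidence being membership. An $(m_k)$ configuration here is an incidence structure with $m$ points and $m$ blocks, each block incident with exactly $k$ points and each point with exactly $k$ blocks. The (combinatorial) Clifford configuration of type $(2^{d-1}_d)$ has as points the vectors of $\{0,1\}^d$ with an even number of 1's, as blocks the vectors with an odd number of 1's, a point and a block being incident iff they differ in exactly one coordinate (so its Levi graph is $Q_d$). An isometric point-circle realization assigns distinct points of the plane to the points and distinct circles of one common radius to the blocks so that each point lies on the circle of every block incident with it. *)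

theory Defs
  imports "HOL-Analysis.Analysis" "Graph_Theory.Graph_Theory"
begin

section \<open>Incidence structures and configurations\<close>

record ('p, 'b) incidence_structure =
  points :: "'p set"
  blocks :: "'b set"
  incidence :: "('p \<times> 'b) set"

definition wf_incidence :: "('p, 'b) incidence_structure \<Rightarrow> bool" where
  "wf_incidence S \<longleftrightarrow> incidence S \<subseteq> points S \<times> blocks S"

definition is_configuration :: "nat \<Rightarrow> nat \<Rightarrow> ('p, 'b) incidence_structure \<Rightarrow> bool" where
  "is_configuration m k S \<longleftrightarrow>
     wf_incidence S \<and>
     finite (points S) \<and> card (points S) = m \<and>
     finite (blocks S) \<and> card (blocks S) = m \<and>
     (\<forall>b\<in>blocks S. card {p \<in> points S. (p, b) \<in> incidence S} = k) \<and>
     (\<forall>p\<in>points S. card {b \<in> blocks S. (p, b) \<in> incidence S} = k)"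

definition incidence_iso ::
  "('p, 'b) incidence_structure \<Rightarrow> ('q, 'c) incidence_structure \<Rightarrow> bool" where
  "incidence_iso S T \<longleftrightarrow>
     (\<exists>f g. bij_betw f (points S) (points T) \<and> bij_betw g (blocks S) (blocks T) \<and>
        (\<forall>p\<in>points S. \<forall>b\<in>blocks S.
           (p, b) \<in> incidence S \<longleftrightarrow> (f p, g b) \<in> incidence T))"

text \<open>
  Since the incidences of \<open>S1\<close> and \<open>S2\<close> are confined to their own points and blocks, no point of
  one part is incident in \<open>S\<close> with a block of the other.
\<close>
definition is_disjoint_union ::
  "('p, 'b) incidence_structure \<Rightarrow> ('p, 'b) incidence_structure \<Rightarrow>
   ('p, 'b) incidence_structure \<Rightarrow> bool" where
  "is_disjoint_union S S1 S2 \<longleftrightarrow>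
     wf_incidence S1 \<and> wf_incidence S2 \<and>
     points S1 \<inter> points S2 = {} \<and> blocks S1 \<inter> blocks S2 = {} \<and>
     points S = points S1 \<union> points S2 \<and> blocks S = blocks S1 \<union> blocks S2 \<and>
     incidence S = incidence S1 \<union> incidence S2"

section \<open>Neighbourhood structure of a graph\<close>

text \<open>An undirected graph is a \<open>pair_graph\<close>: a finite, loop-free digraph with symmetric arcs.\<close>

definition nbhd :: "'a pair_pre_digraph \<Rightarrow> 'a \<Rightarrow> 'a set" where
  "nbhd G v = {u \<in> pverts G. (v, u) \<in> parcs G}"

definition nbhd_structure :: "'a pair_pre_digraph \<Rightarrow> ('a, 'a set) incidence_structure" where
  "nbhd_structure G =
     \<lparr> points = pverts G,
       blocks = nbhd G ` pverts G,
       incidence = {(p, b). p \<in> pverts G \<and> b \<in> nbhd G ` pverts G \<and> p \<in> b} \<rparr>"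

section \<open>Cubes and Clifford configurations\<close>

text \<open>Vectors are extensional functions on \<open>{..<d}\<close>, so that they are determined by their entries.\<close>

definition bin_vectors :: "nat \<Rightarrow> (nat \<Rightarrow> nat) set" where
  "bin_vectors d = {..<d} \<rightarrow>\<^sub>E {0, 1}"

definition differ_in_one :: "nat \<Rightarrow> (nat \<Rightarrow> nat) \<Rightarrow> (nat \<Rightarrow> nat) \<Rightarrow> bool" where
  "differ_in_one d x y \<longleftrightarrow> card {i \<in> {..<d}. x i \<noteq> y i} = 1"

definition num_ones :: "nat \<Rightarrow> (nat \<Rightarrow> nat) \<Rightarrow> nat" where
  "num_ones d x = card {i \<in> {..<d}. x i = 1}"

definition cube :: "nat \<Rightarrow> (nat \<Rightarrow> nat) pair_pre_digraph" where
  "cube d =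
     \<lparr> pverts = bin_vectors d,
       parcs = {(x, y). x \<in> bin_vectors d \<and> y \<in> bin_vectors d \<and> differ_in_one d x y} \<rparr>"

lemma pair_graph_cube: "pair_graph (cube d)"
proof -
  have fin: "finite (bin_vectors d)"
    by (simp add: bin_vectors_def finite_PiE)
  have arcs: "parcs (cube d) \<subseteq> bin_vectors d \<times> bin_vectors d"
    by (auto simp: cube_def)
  have "differ_in_one d x y \<Longrightarrow> differ_in_one d y x" for x y
    by (simp add: differ_in_one_def eq_commute)
  hence "sym (parcs (cube d))"
    by (auto simp: cube_def sym_def)
  moreover have "finite (parcs (cube d))"
    using arcs fin by (meson finite_SigmaI finite_subset)
  ultimately show ?thesis
    using fin by unfold_locales (auto simp: cube_def symmetric_def differ_in_one_def)
qed

definition clifford_configuration ::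
  "nat \<Rightarrow> (nat \<Rightarrow> nat, nat \<Rightarrow> nat) incidence_structure" where
  "clifford_configuration d =
     \<lparr> points = {x \<in> bin_vectors d. even (num_ones d x)},
       blocks = {y \<in> bin_vectors d. odd (num_ones d y)},
       incidence = {(x, y). x \<in> bin_vectors d \<and> even (num_ones d x) \<and>
                            y \<in> bin_vectors d \<and> odd (num_ones d y) \<and> differ_in_one d x y} \<rparr>"

section \<open>Isometric point-circle realizations\<close>

text \<open>
  Circles are nondegenerate. A circle may pass through points whose incidence with the
  corresponding block is not required.
\<close>
definition isometric_realization ::
  "('p, 'b) incidence_structure \<Rightarrow> ('p \<Rightarrow> real^2) \<Rightarrow> ('b \<Rightarrow> (real^2) set) \<Rightarrow> bool" where
  "isometric_realization S pt circ \<longleftrightarrow>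
     inj_on pt (points S) \<and> inj_on circ (blocks S) \<and>
     (\<exists>r>0. \<forall>b\<in>blocks S. \<exists>c. circ b = sphere c r) \<and>
     (\<forall>p\<in>points S. \<forall>b\<in>blocks S. (p, b) \<in> incidence S \<longrightarrow> pt p \<in> circ b)"

definition isometric_point_circle_configuration ::
  "nat \<Rightarrow> nat \<Rightarrow> ('p, 'b) incidence_structure \<Rightarrow>
   ('p \<Rightarrow> real^2) \<Rightarrow> ('b \<Rightarrow> (real^2) set) \<Rightarrow> bool" where
  "isometric_point_circle_configuration m k S pt circ \<longleftrightarrow>
     is_configuration m k S \<and> isometric_realization S pt circ"

end

theory Submission
  imports Defs "HOL-Library.Nat_Bijection"
begin

text \<open>
  Sending a \<open>0/1\<close>-vector to the sum of the unit vectors \<open>u\<^sub>i\<close> over its entries equal to \<open>1\<close> turns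
  \<open>Q\<^sub>d\<close> into a unit distance graph, so the unit circle around the image of \<open>v\<close> passes through the
  images of all neighbours of \<open>v\<close>. If \<open>u\<^sub>i\<close> has second coordinate \<open>2\<^sup>i / 2\<^sup>d\<close>, that map is injective
  by uniqueness of binary expansions. The two components come from the bipartition of \<open>Q\<^sub>d\<close> by
  parity, and flipping one coordinate exchanges them.
\<close>

section \<open>Neighbourhood structures restricted to vertex sets\<close>

text \<open>Points and blocks are indexed by separate vertex sets, so that one definition covers
  both \<open>nbhd_structure G\<close> and each component of the cube, where \<open>A\<close> and
  \<open>B\<close> have opposite parities. The blocks stay full neighbourhoods and are not cut down
  to \<open>A\<close>.\<close>

definition nbhd_restriction ::
  "'a pair_pre_digraph \<Rightarrow> 'a set \<Rightarrow> 'a set \<Rightarrow> ('a, 'a set) incidence_structure" where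
  "nbhd_restriction G A B =
     \<lparr> points = A, blocks = nbhd G ` B,
       incidence = {(p, b). p \<in> A \<and> b \<in> nbhd G ` B \<and> p \<in> b} \<rparr>"

lemma nbhd_restriction_simps [simp]:
  "points (nbhd_restriction G A B) = A"
  "blocks (nbhd_restriction G A B) = nbhd G ` B"
  "(p, b) \<in> incidence (nbhd_restriction G A B) \<longleftrightarrow> p \<in> A \<and> b \<in> nbhd G ` B \<and> p \<in> b"
  by (auto simp: nbhd_restriction_def)

lemma wf_nbhd_restriction: "wf_incidence (nbhd_restriction G A B)"
  by (auto simp: wf_incidence_def)

lemma nbhd_structure_eq_restriction:
  "nbhd_structure G = nbhd_restriction G (pverts G) (pverts G)"
  by (simp add: nbhd_structure_def nbhd_restriction_def)

lemma nbhd_subset: "nbhd G v \<subseteq> pverts G"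
  by (auto simp: nbhd_def)

lemma nbhd_sym:
  assumes "pair_graph G" "u \<in> nbhd G v" "v \<in> pverts G"
  shows "v \<in> nbhd G u"
proof -
  interpret pair_graph G by fact
  show ?thesis
    using assms(2,3) arcs_symmetric[of v u] by (auto simp: nbhd_def)
qed

text \<open>By injectivity, blocks correspond to the vertices of \<open>B\<close>. By symmetry of
  adjacency, the blocks through \<open>p\<close> are the neighbourhoods of the neighbours of
  \<open>p\<close>. Since neighbourhoods stay inside the opposite set, both incidence counts are
  vertex degrees.\<close>

lemma is_configuration_nbhd_restriction:
  assumes "pair_graph G" and inj: "inj_on (nbhd G) (pverts G)"
    and reg: "\<And>v. v \<in> pverts G \<Longrightarrow> card (nbhd G v) = k"
    and A: "A \<subseteq> pverts G" and B: "B \<subseteq> pverts G" and card: "card A = m" "card B = m"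
    and AB: "\<And>v. v \<in> A \<Longrightarrow> nbhd G v \<subseteq> B" and BA: "\<And>v. v \<in> B \<Longrightarrow> nbhd G v \<subseteq> A"
  shows "is_configuration m k (nbhd_restriction G A B)"
proof -
  interpret pair_graph G by fact
  have fin: "finite A" "finite B"
    using A B finite_subset[OF _ pair_finite_verts] by auto
  have "card (nbhd G ` B) = m"
    using card_image[OF inj_on_subset[OF inj B]] card by simp
  moreover have "card {p \<in> A. p \<in> A \<and> nbhd G v \<in> nbhd G ` B \<and> p \<in> nbhd G v} = k" if "v \<in> B" for v
  proof -
    have "{p \<in> A. p \<in> A \<and> nbhd G v \<in> nbhd G ` B \<and> p \<in> nbhd G v} = nbhd G v"
      using BA[OF that] that by auto
    then show ?thesis
      using reg B that by auto
  qed
  moreover have "card {b \<in> nbhd G ` B. p \<in> A \<and> b \<in> nbhd G ` B \<and> p \<in> b} = k" if p: "p \<in> A" for p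
  proof -
    have "p \<in> nbhd G v \<longleftrightarrow> v \<in> nbhd G p" if "v \<in> B" for v
      using nbhd_sym[OF \<open>pair_graph G\<close>] that A B p by blast
    then have "{b \<in> nbhd G ` B. p \<in> A \<and> b \<in> nbhd G ` B \<and> p \<in> b} = nbhd G ` nbhd G p"
      using AB[OF p] p by auto
    moreover have "inj_on (nbhd G) (nbhd G p)"
      using inj nbhd_subset by (rule inj_on_subset)
    ultimately show ?thesis
      using reg A p by (auto simp: card_image)
  qed
  ultimately show ?thesis
    using fin card by (simp add: is_configuration_def wf_nbhd_restriction)
qed

section \<open>Unit circles around the vertices of a unit distance drawing\<close>

text \<open>If the centres differ, the point \<open>p\<close> of the first sphere farthest from
  \<open>c'\<close> lies at distance \<open>n + r\<close> from \<open>c'\<close>, hence off the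
  second sphere.\<close>

lemma sphere_inject:
  fixes c c' :: "'a::euclidean_space"
  assumes "sphere c r = sphere c' r" "r > 0"
  shows "c = c'"
proof (rule ccontr)
  assume ne: "c \<noteq> c'"
  define n where "n = norm (c - c')"
  have n: "n > 0" using ne by (simp add: n_def)
  define p where "p = c + (r / n) *\<^sub>R (c - c')"
  have "dist c p = r"
    using n assms(2) by (simp add: p_def dist_norm flip: n_def)
  then have "norm (p - c') = r"
    using assms(1) by (metis mem_sphere dist_commute dist_norm)
  moreover have "p - c' = (1 + r / n) *\<^sub>R (c - c')"
    by (simp add: p_def algebra_simps)
  then have "norm (p - c') = (1 + r / n) * n"
    using n assms(2) by (simp add: n_def)
  then have "norm (p - c') = n + r"
    using n by (simp add: distrib_right)
  ultimately show False using n by simp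
qed

text \<open>A block is a set of vertices, so its centre is recovered by inverting
  \<open>nbhd G\<close>; this is meaningful once \<open>nbhd G\<close> is injective.\<close>

definition nbhd_circle ::
  "'a pair_pre_digraph \<Rightarrow> ('a \<Rightarrow> real^2) \<Rightarrow> 'a set \<Rightarrow> (real^2) set" where
  "nbhd_circle G pt b = sphere (pt (the_inv_into (pverts G) (nbhd G) b)) 1"

lemma isometric_realization_nbhd_restriction:
  assumes inj: "inj_on (nbhd G) (pverts G)" and pt: "inj_on pt (pverts G)"
    and unit: "\<And>u v. (u, v) \<in> parcs G \<Longrightarrow> dist (pt u) (pt v) = 1"
    and A: "A \<subseteq> pverts G" and B: "B \<subseteq> pverts G"
  shows "isometric_realization (nbhd_restriction G A B) pt (nbhd_circle G pt)"
proof -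
  have circ: "nbhd_circle G pt (nbhd G v) = sphere (pt v) 1" if "v \<in> B" for v
    using the_inv_into_f_f[OF inj] that B by (auto simp: nbhd_circle_def)
  have "inj_on (nbhd_circle G pt) (nbhd G ` B)"
  proof (rule inj_onI, clarsimp simp: circ)
    fix v w assume "v \<in> B" "w \<in> B" "sphere (pt v) 1 = sphere (pt w) 1"
    then have "v = w"
      using sphere_inject[of "pt v" 1 "pt w"] pt B by (auto dest: inj_onD)
    then show "nbhd G v = nbhd G w" by simp
  qed
  moreover have "pt p \<in> nbhd_circle G pt (nbhd G v)" if "v \<in> B" "p \<in> nbhd G v" for p v
    using that unit[of v p] by (simp add: circ) (simp add: nbhd_def)
  moreover have "\<exists>c. nbhd_circle G pt b = sphere c 1" for b
    by (auto simp: nbhd_circle_def)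
  ultimately show ?thesis
    using inj_on_subset[OF pt A]
    unfolding isometric_realization_def by (auto intro: zero_less_one)
qed

section \<open>The cube\<close>

text \<open>Truncated subtraction swaps 0 and 1, so \<open>flip i\<close> is an involution on binary
  vectors.\<close>

definition flip :: "nat \<Rightarrow> (nat \<Rightarrow> nat) \<Rightarrow> nat \<Rightarrow> nat" where
  "flip i x = x(i := 1 - x i)"

lemma bin_vectors_cases: "x \<in> bin_vectors d \<Longrightarrow> i < d \<Longrightarrow> x i = 0 \<or> x i = 1"
  by (auto simp: bin_vectors_def PiE_iff)

lemma flip_bin_vectors: "x \<in> bin_vectors d \<Longrightarrow> i < d \<Longrightarrow> flip i x \<in> bin_vectors d"
  by (auto simp: bin_vectors_def flip_def PiE_iff extensional_def)

lemma flip_flip: "x \<in> bin_vectors d \<Longrightarrow> i < d \<Longrightarrow> flip i (flip i x) = x"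
  using bin_vectors_cases[of x d i] by (auto simp: flip_def)

lemma flip_neq: "x \<in> bin_vectors d \<Longrightarrow> i < d \<Longrightarrow> flip i x i \<noteq> x i"
  using bin_vectors_cases[of x d i] by (auto simp: flip_def)

lemma differ_in_one_iff_flip:
  assumes "x \<in> bin_vectors d" "y \<in> bin_vectors d"
  shows "differ_in_one d x y \<longleftrightarrow> (\<exists>i<d. y = flip i x)"
proof
  assume "differ_in_one d x y"
  then obtain i where i: "{i \<in> {..<d}. x i \<noteq> y i} = {i}"
    by (auto simp: differ_in_one_def card_1_singleton_iff)
  then have "i < d" "x i \<noteq> y i" and eq: "\<And>j. j < d \<Longrightarrow> j \<noteq> i \<Longrightarrow> x j = y j"
    by auto
  then have "y i = 1 - x i"
    using bin_vectors_cases[OF assms(1), of i] bin_vectors_cases[OF assms(2), of i] by auto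
  moreover have "x j = y j" if "j \<noteq> i" for j
    using assms eq that
    by (cases "j < d") (auto simp: bin_vectors_def PiE_iff extensional_def)
  ultimately have "y = flip i x"
    by (simp add: flip_def fun_eq_iff)
  with \<open>i < d\<close> show "\<exists>i<d. y = flip i x" by blast
next
  assume "\<exists>i<d. y = flip i x"
  then obtain i where i: "i < d" "y = flip i x" by blast
  have "{j \<in> {..<d}. x j \<noteq> y j} = {i}"
    using i flip_neq[OF assms(1) i(1)] by (auto simp: flip_def)
  then show "differ_in_one d x y" by (simp add: differ_in_one_def)
qed

lemma pverts_cube [simp]: "pverts (cube d) = bin_vectors d"
  by (simp add: cube_def)

lemma mem_nbhd_cube:
  "x \<in> bin_vectors d \<Longrightarrow>
    y \<in> nbhd (cube d) x \<longleftrightarrow> y \<in> bin_vectors d \<and> differ_in_one d x y"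
  by (auto simp: nbhd_def cube_def)

lemma nbhd_cube:
  assumes "x \<in> bin_vectors d"
  shows "nbhd (cube d) x = (\<lambda>i. flip i x) ` {..<d}"
  using assms by (auto simp: mem_nbhd_cube differ_in_one_iff_flip flip_bin_vectors)

lemma card_nbhd_cube:
  assumes "x \<in> bin_vectors d"
  shows "card (nbhd (cube d) x) = d"
proof -
  have "inj_on (\<lambda>i. flip i x) {..<d}"
  proof (rule inj_onI)
    fix i j assume "i \<in> {..<d}" "j \<in> {..<d}" "flip i x = flip j x"
    then show "i = j"
      using flip_neq[OF assms, of i] by (auto simp: flip_def split: if_splits)
  qed
  then show ?thesis by (simp add: nbhd_cube[OF assms] card_image)
qed

text \<open>Three coordinates leave two indices besides one where \<open>x\<close> and
  \<open>y\<close> differ, and flipping \<open>x\<close> at either would have to give the same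
  values off that coordinate. In the 4-cycle \<open>cube 2\<close>, opposite vertices do share their
  neighbourhoods.\<close>

lemma inj_on_nbhd_cube:
  assumes "d \<ge> 3"
  shows "inj_on (nbhd (cube d)) (bin_vectors d)"
proof (rule inj_onI, rule ccontr)
  fix x y assume x: "x \<in> bin_vectors d" and y: "y \<in> bin_vectors d"
    and N: "nbhd (cube d) x = nbhd (cube d) y" and "x \<noteq> y"
  then obtain j where j: "j < d" "x j \<noteq> y j"
    using PiE_ext[of x "{..<d}" "\<lambda>_. {0, 1}" y] by (auto simp: bin_vectors_def)
  \<comment> \<open>A neighbour of \<open>x\<close> obtained by flipping \<open>i \<noteq> j\<close> already differs from \<open>y\<close> at \<open>j\<close>.\<close>
  have agree: "flip i x k = y k" if i: "i < d" "i \<noteq> j" and k: "k \<noteq> j" for i k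
  proof -
    have "flip i x \<in> nbhd (cube d) y"
      using N nbhd_cube[OF x] i by auto
    then obtain l where l: "l < d" "flip i x = flip l y"
      using nbhd_cube[OF y] by auto
    have "flip i x j = x j" using i by (simp add: flip_def)
    with l j have "l = j" by (auto simp: flip_def split: if_splits)
    with l k show ?thesis by (simp add: flip_def)
  qed
  \<comment> \<open>Two distinct indices below 3 that both avoid \<open>j\<close>.\<close>
  define i where "i = (if j = 0 then 1 else 0 :: nat)"
  define i' where "i' = (if j = 2 then 1 else 2 :: nat)"
  have i: "i < d" "i' < d" "i \<noteq> j" "i' \<noteq> j" "i \<noteq> i'"
    using assms by (auto simp: i_def i'_def)
  \<comment> \<open>Both sides equal \<open>y i\<close> by \<open>agree\<close>, while the right one
    is still \<open>x i\<close> because \<open>i \<noteq> i'\<close>.\<close>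
  have "flip i x i = flip i' x i"
    using agree i by metis
  then show False
    using flip_neq[OF x i(1)] i by (simp add: flip_def)
qed

lemma card_bin_vectors: "card (bin_vectors d) = 2 ^ d"
  by (simp add: bin_vectors_def card_PiE numeral_2_eq_2)

lemma finite_bin_vectors: "finite (bin_vectors d)"
  by (simp add: bin_vectors_def finite_PiE)

section \<open>Parity\<close>

definition ones :: "nat \<Rightarrow> (nat \<Rightarrow> nat) \<Rightarrow> nat set" where
  "ones d x = {i \<in> {..<d}. x i = 1}"

lemma finite_ones [simp]: "finite (ones d x)"
  by (simp add: ones_def)

text \<open>Either way a fresh index is inserted into a finite set, so one case split serves both
  the parity of the cardinality and the sum of edge vectors.\<close>

lemma ones_flip_cases:
  assumes "x \<in> bin_vectors d" "i < d"
  obtains "i \<notin> ones d x" "ones d (flip i x) = insert i (ones d x)"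
        | "i \<notin> ones d (flip i x)" "ones d x = insert i (ones d (flip i x))"
proof (cases "x i = 1")
  case True
  with assms(2) have "i \<notin> ones d (flip i x)" "ones d x = insert i (ones d (flip i x))"
    by (auto simp: ones_def flip_def)
  then show ?thesis by (rule that(2))
next
  case False
  with bin_vectors_cases[OF assms] assms(2)
  have "i \<notin> ones d x" "ones d (flip i x) = insert i (ones d x)"
    by (auto simp: ones_def flip_def)
  then show ?thesis by (rule that(1))
qed

lemma inj_on_ones: "inj_on (ones d) (bin_vectors d)"
proof (rule inj_onI)
  fix x y assume x: "x \<in> bin_vectors d" and y: "y \<in> bin_vectors d" and eq: "ones d x = ones d y"
  show "x = y"
  proof (rule PiE_ext[of x "{..<d}" "\<lambda>_. {0, 1}"])
    fix i assume i: "i \<in> {..<d}"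
    have "i \<in> ones d x \<longleftrightarrow> i \<in> ones d y"
      using eq by simp
    with i have "x i = 1 \<longleftrightarrow> y i = 1"
      by (simp add: ones_def)
    then show "x i = y i"
      using i bin_vectors_cases[OF x, of i] bin_vectors_cases[OF y, of i] by auto
  qed (use x y in \<open>simp_all add: bin_vectors_def\<close>)
qed

lemma even_num_ones_flip:
  assumes "x \<in> bin_vectors d" "i < d"
  shows "even (num_ones d (flip i x)) \<longleftrightarrow> odd (num_ones d x)"
  unfolding num_ones_def ones_def[symmetric]
  by (rule ones_flip_cases[OF assms]) simp_all

text \<open>With a Boolean parameter the other class is \<open>\<not> e\<close>, so each fact is
  proved once for both parities.\<close>

definition parity_class :: "nat \<Rightarrow> bool \<Rightarrow> (nat \<Rightarrow> nat) set" where
  "parity_class d e = {x \<in> bin_vectors d. even (num_ones d x) = e}"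

lemma parity_class_subset: "parity_class d e \<subseteq> bin_vectors d"
  by (auto simp: parity_class_def)

lemma parity_class_Un: "parity_class d e \<union> parity_class d (\<not> e) = bin_vectors d"
  by (auto simp: parity_class_def)

lemma parity_class_Int: "parity_class d e \<inter> parity_class d (\<not> e) = {}"
  by (auto simp: parity_class_def)

lemma nbhd_parity_class:
  "x \<in> parity_class d e \<Longrightarrow> nbhd (cube d) x \<subseteq> parity_class d (\<not> e)"
  by (auto simp: parity_class_def nbhd_cube flip_bin_vectors even_num_ones_flip)

lemma bij_betw_flip_parity_class:
  assumes "i < d"
  shows "bij_betw (flip i) (parity_class d e) (parity_class d (\<not> e))"
  by (rule bij_betwI[where g = "flip i"])
    (use assms in \<open>auto simp: parity_class_def flip_bin_vectors even_num_ones_flip flip_flip\<close>)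

text \<open>Flipping coordinate 0 matches the two classes, so each is half of the cube.\<close>

lemma card_parity_class:
  assumes "d > 0"
  shows "card (parity_class d e) = 2 ^ (d - 1)"
proof -
  have "card (parity_class d e) = card (parity_class d (\<not> e))"
    using bij_betw_same_card[OF bij_betw_flip_parity_class[OF assms]] .
  moreover have "card (parity_class d e) + card (parity_class d (\<not> e)) = 2 ^ d"
    using card_Un_disjoint[OF _ _ parity_class_Int, of d e]
      finite_subset[OF parity_class_subset finite_bin_vectors, of d]
    by (simp add: parity_class_Un card_bin_vectors)
  moreover have "(2::nat) ^ d = 2 * 2 ^ (d - 1)"
    using assms by (cases d) simp_all
  ultimately show ?thesis by simp
qed

section \<open>The components as Clifford configurations\<close>

text \<open>Adjacent vertices have opposite parity, so the blocks meeting class \<open>e\<close> are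
  the neighbourhoods of the vertices in the other class.\<close>

abbreviation cube_component :: "nat \<Rightarrow> bool \<Rightarrow> (nat \<Rightarrow> nat, (nat \<Rightarrow> nat) set) incidence_structure"
  where "cube_component d e \<equiv> nbhd_restriction (cube d) (parity_class d e) (parity_class d (\<not> e))"

lemma differ_in_one_commute: "differ_in_one d x y \<longleftrightarrow> differ_in_one d y x"
  by (simp add: differ_in_one_def eq_commute)

lemma differ_in_one_flip:
  assumes "x \<in> bin_vectors d" "y \<in> bin_vectors d" "i < d"
  shows "differ_in_one d (flip i x) (flip i y) \<longleftrightarrow> differ_in_one d x y"
proof -
  have "{j \<in> {..<d}. flip i x j \<noteq> flip i y j} = {j \<in> {..<d}. x j \<noteq> y j}"
    using bin_vectors_cases[OF assms(1,3)] bin_vectors_cases[OF assms(2,3)]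
    by (auto simp: flip_def)
  then show ?thesis by (simp add: differ_in_one_def)
qed

text \<open>A point \<open>p\<close> goes to \<open>f p\<close> and a block, the neighbourhood of
  \<open>v\<close>, to \<open>f v\<close>; incidence is adjacency of \<open>p\<close> and
  \<open>v\<close>, which \<open>f\<close> preserves. The map \<open>f\<close> is there to bring the
  points to even parity.\<close>

lemma incidence_iso_cube_component:
  assumes d: "d \<ge> 3"
    and f: "bij_betw f (parity_class d e) (parity_class d True)"
      "bij_betw f (parity_class d (\<not> e)) (parity_class d False)"
    and adj: "\<And>x y. x \<in> bin_vectors d \<Longrightarrow> y \<in> bin_vectors d \<Longrightarrow>
      differ_in_one d (f x) (f y) \<longleftrightarrow> differ_in_one d x y"
  shows "incidence_iso (cube_component d e) (clifford_configuration d)"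
proof -
  let ?h = "the_inv_into (bin_vectors d) (nbhd (cube d))"
  note inj = inj_on_nbhd_cube[OF d]
  have h: "?h (nbhd (cube d) v) = v" if "v \<in> bin_vectors d" for v
    using the_inv_into_f_f[OF inj that] .
  have "bij_betw ?h (nbhd (cube d) ` parity_class d (\<not> e)) (parity_class d (\<not> e))"
    by (rule bij_betwI[where g = "nbhd (cube d)"])
      (use h parity_class_subset[of d "\<not> e"] in auto)
  then have "bij_betw (f \<circ> ?h) (nbhd (cube d) ` parity_class d (\<not> e)) (parity_class d False)"
    using f(2) by (rule bij_betw_trans)
  moreover have "p \<in> nbhd (cube d) v \<longleftrightarrow> (f p, f v) \<in> incidence (clifford_configuration d)"
    if p: "p \<in> parity_class d e" and v: "v \<in> parity_class d (\<not> e)" for p v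
  proof -
    have "f p \<in> parity_class d True" "f v \<in> parity_class d False"
      using f p v by (auto simp: bij_betw_def)
    moreover have "p \<in> bin_vectors d" "v \<in> bin_vectors d"
      using p v by (auto simp: parity_class_def)
    ultimately show ?thesis
      using adj[of p v] differ_in_one_commute[of d p v]
      by (auto simp: clifford_configuration_def parity_class_def mem_nbhd_cube)
  qed
  moreover have "points (clifford_configuration d) = parity_class d True"
    "blocks (clifford_configuration d) = parity_class d False"
    by (auto simp: clifford_configuration_def parity_class_def)
  ultimately show ?thesis
    unfolding incidence_iso_def
    by (intro exI[of _ f] exI[of _ "f \<circ> ?h"])
      (use f(1) h parity_class_subset[of d "\<not> e"] in \<open>auto simp: subset_iff\<close>)
qed

section \<open>The cube as a unit distance graph\<close>

text \<open>The scaling by \<open>2 ^ d\<close> keeps the second coordinate at most 1 for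
  \<open>i < d\<close>; the first one completes it to a unit vector.\<close>

definition edge_vector :: "nat \<Rightarrow> nat \<Rightarrow> real^2" where
  "edge_vector d i = vector [sqrt (1 - (2 ^ i / 2 ^ d)\<^sup>2), 2 ^ i / 2 ^ d]"

definition cube_point :: "nat \<Rightarrow> (nat \<Rightarrow> nat) \<Rightarrow> real^2" where
  "cube_point d x = (\<Sum>i\<in>ones d x. edge_vector d i)"

lemma norm_edge_vector:
  assumes "i < d"
  shows "norm (edge_vector d i) = 1"
proof -
  have "(2 ^ i / 2 ^ d :: real) \<le> 1"
    using assms by (simp add: power_increasing)
  \<comment> \<open>The radicand in \<open>edge_vector\<close> is therefore nonnegative, so squaring
    the root gives it back.\<close>
  then have "(2 ^ i / 2 ^ d :: real)\<^sup>2 \<le> 1"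
    by (simp add: power_le_one)
  then show ?thesis
    by (simp add: norm_eq_sqrt_inner inner_vec_def sum_2 edge_vector_def flip: power2_eq_square)
qed

text \<open>Moving along an edge adds or removes a single edge vector.\<close>

lemma dist_cube_point:
  assumes "(x, y) \<in> parcs (cube d)"
  shows "dist (cube_point d x) (cube_point d y) = 1"
proof -
  have x: "x \<in> bin_vectors d" and y: "y \<in> bin_vectors d" "differ_in_one d x y"
    using assms by (auto simp: cube_def)
  then obtain i where i: "i < d" "y = flip i x"
    using differ_in_one_iff_flip by blast
  show ?thesis
    by (rule ones_flip_cases[OF x i(1)])
      (simp_all add: i(2) cube_point_def dist_norm norm_edge_vector[OF i(1)])
qed

lemma inj_on_cube_point: "inj_on (cube_point d) (bin_vectors d)"
proof (rule inj_onI)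
  fix x y assume xy: "x \<in> bin_vectors d" "y \<in> bin_vectors d" "cube_point d x = cube_point d y"
  \<comment> \<open>Up to scaling, the second coordinate is the binary code of the set of ones, and
    \<open>set_encode\<close> is injective on finite sets.\<close>
  have snd_coord: "cube_point d z $ 2 = real (set_encode (ones d z)) / 2 ^ d" for z
  proof -
    have "cube_point d z $ 2 = (\<Sum>i\<in>ones d z. 2 ^ i / 2 ^ d)"
      by (simp add: cube_point_def edge_vector_def)
    also have "\<dots> = (\<Sum>i\<in>ones d z. 2 ^ i) / 2 ^ d"
      by (rule sum_divide_distrib[symmetric])
    finally show ?thesis
      by (simp add: set_encode_def)
  qed
  have "real (set_encode (ones d x)) = real (set_encode (ones d y))"
    using snd_coord[of x] snd_coord[of y] xy(3) by simp
  then have "ones d x = ones d y"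
    by (simp add: set_encode_eq)
  then show "x = y"
    using inj_onD[OF inj_on_ones] xy by blast
qed

theorem theorem4p3:
  fixes d :: nat
  assumes "d \<ge> 3"
  shows "is_configuration (2 ^ d) d (nbhd_structure (cube d)) \<and>
    (\<exists>S1 S2.
       is_disjoint_union (nbhd_structure (cube d)) S1 S2 \<and>
       incidence_iso S1 (clifford_configuration d) \<and>
       incidence_iso S2 (clifford_configuration d) \<and>
       (\<exists>pt circ.
          isometric_point_circle_configuration (2 ^ d) d (nbhd_structure (cube d)) pt circ \<and>
          isometric_point_circle_configuration (2 ^ (d - 1)) d S1 pt circ \<and>
          isometric_point_circle_configuration (2 ^ (d - 1)) d S2 pt circ))"
proof -
  let ?S = "nbhd_structure (cube d)"
  let ?pt = "cube_point d" and ?circ = "nbhd_circle (cube d) (cube_point d)"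
  have d: "0 < d" using assms by simp
  note inj = inj_on_nbhd_cube[OF assms]
  \<comment> \<open>Leaving \<open>A\<close> and \<open>B\<close> free lets the same points and
    circles serve the whole structure and both components.\<close>
  have real: "isometric_realization (nbhd_restriction (cube d) A B) ?pt ?circ"
    if "A \<subseteq> bin_vectors d" "B \<subseteq> bin_vectors d" for A B
    by (rule isometric_realization_nbhd_restriction)
      (use that inj inj_on_cube_point dist_cube_point in auto)
  have conf: "is_configuration (2 ^ d) d ?S"
    unfolding nbhd_structure_eq_restriction
    by (rule is_configuration_nbhd_restriction[OF pair_graph_cube])
      (use inj nbhd_subset[of "cube d"] in \<open>simp_all add: card_nbhd_cube card_bin_vectors\<close>)
  have conf_component: "is_configuration (2 ^ (d - 1)) d (cube_component d e)" for e
    by (rule is_configuration_nbhd_restriction[OF pair_graph_cube])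
      (use inj parity_class_subset nbhd_parity_class[of _ d e] nbhd_parity_class[of _ d "\<not> e"]
        in \<open>simp_all add: card_nbhd_cube card_parity_class[OF d]\<close>)
  have "isometric_point_circle_configuration (2 ^ d) d ?S ?pt ?circ"
    using conf real[of "bin_vectors d" "bin_vectors d"]
    by (simp add: isometric_point_circle_configuration_def nbhd_structure_eq_restriction)
  moreover have
    "isometric_point_circle_configuration (2 ^ (d - 1)) d (cube_component d e) ?pt ?circ" for e
    using conf_component real parity_class_subset
    by (simp add: isometric_point_circle_configuration_def)
  moreover have "incidence_iso (cube_component d True) (clifford_configuration d)"
    by (rule incidence_iso_cube_component[OF assms, of "\<lambda>x. x"]) (auto simp: bij_betw_def)
  \<comment> \<open>Here the points are the odd vectors; flipping coordinate 0 makes them even and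
    preserves adjacency.\<close>
  moreover have "incidence_iso (cube_component d False) (clifford_configuration d)"
    by (rule incidence_iso_cube_component[OF assms, of "flip 0"])
      (use bij_betw_flip_parity_class[OF d, of True] bij_betw_flip_parity_class[OF d, of False] d
        in \<open>simp_all add: differ_in_one_flip\<close>)
  moreover have "is_disjoint_union ?S (cube_component d True) (cube_component d False)"
  proof -
    have vertices: "bin_vectors d = parity_class d True \<union> parity_class d False"
      using parity_class_Un[of d True] by simp
    have disj: "parity_class d True \<inter> parity_class d False = {}"
      using parity_class_Int[of d True] by simp
    \<comment> \<open>An injective map keeps the images of the disjoint parity classes
      disjoint.\<close>
    have "nbhd (cube d) ` parity_class d False \<inter> nbhd (cube d) ` parity_class d True = {}"
      using inj_on_image_Int[OF inj parity_class_subset parity_class_subset, of False True] disj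
      by auto
    \<comment> \<open>If \<open>p\<close> lies in the neighbourhood of \<open>v\<close>, their
      parities differ, so the incidence belongs to the component that has \<open>p\<close> as a
      point.\<close>
    moreover have "incidence ?S =
        incidence (cube_component d True) \<union> incidence (cube_component d False)"
      using nbhd_parity_class[of _ d True] nbhd_parity_class[of _ d False] disj
      by (fastforce simp: nbhd_structure_eq_restriction nbhd_restriction_def vertices)
    ultimately show ?thesis
      using disj by (auto simp: is_disjoint_union_def wf_nbhd_restriction
          nbhd_structure_eq_restriction vertices)
  qed
  ultimately show ?thesis
    using conf by blast
qed

end
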